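(* For each $c \in \mathbb{Z}$, the fiber $\{ n \in \mathbb{N}_0 : f(n) = c \}$ is finite, where $(f(n))_{n \ge 0}$ is the sequence of complementary Bell numbers.
   Context: $\mathbb{N}_0$ denotes the set of nonnegative integers. Let $\left\{ \begin{smallmatrix} n \\ k \end{smallmatrix} \right\}$ denote the Stirling number of the second kind, i.e., the number of set-partitions of an $n$-element set into $k$ (nonempty) subsets. The Bell polynomials are $B_n(x) = \sum_{k=0}^{n} \left\{ \begin{smallmatrix} n \\ k \end{smallmatrix} \right\} x^k$. The complementary Bell numbers are the integers $f(n) = B_n(-1) = \sum_{k=0}^{n} (-1)^k \left\{ \begin{smallmatrix} n \\ k \end{smallmatrix} \right\}$ for $n \in \mathbb{N}_0$ (so $f(0)=1$). *)

theory Defs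
  imports
    "HOL-Combinatorics.Stirling"
    "HOL-Computational_Algebra.Polynomial"
    "HOL-Library.Disjoint_Sets"
begin

text \<open>
  \<^const>\<open>Stirling\<close> is defined by its recurrence; the lemma below identifies it
  with the number of set partitions into a given number of blocks. The blocks of
  a \<^const>\<open>partition_on\<close> are nonempty.
\<close>

lemma Stirling_eq_card_partitions:
  assumes "finite A"
  shows "Stirling (card A) k = card {P. partition_on A P \<and> card P = k}"
  using assms
proof (induction A arbitrary: k rule: finite_induct)
  case empty
  have eq: "{P. partition_on {} P \<and> card P = k} = (if k = 0 then {{} :: 'a set set} else {})"
    by (auto simp: partition_on_empty)
  show ?case unfolding eq by (cases k) auto
next
  case (insert x A)
  show ?case
  proof (cases k)
    case 0
    have "card P \<noteq> 0" if "partition_on (insert x A) P" for P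
    proof -
      have "finite P" "P \<noteq> {}"
        using that insert.hyps finite_elements[of "insert x A" P] by (auto simp: partition_on_def)
      then show ?thesis by simp
    qed
    then have "{P. partition_on (insert x A) P \<and> card P = k} = {}"
      using 0 by auto
    then show ?thesis using 0 insert.hyps by (simp only: card.empty) simp
  next
    case (Suc m)
    let ?Q = "\<lambda>j. {P. partition_on A P \<and> card P = j}"
    let ?g = "\<lambda>(P, B). insert (insert x B) (P - {B})"
    have fin: "finite P" if "partition_on A P" for P
      using that insert.hyps finite_elements by blast
    have finQ: "finite (?Q j)" for j
      by (rule finite_subset[of _ "Pow (Pow A)"]) (auto simp: partition_on_def insert.hyps)
    have nx: "x \<notin> B" if "partition_on A P" "B \<in> P" for P B
      using that insert.hyps by (auto simp: partition_on_def)
    have nA: "B \<noteq> {}" if "partition_on A P" "B \<in> P" for P B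
      using that by (auto simp: partition_on_def)
    have eq: "{P. partition_on (insert x A) P \<and> card P = Suc m} =
        insert {x} ` ?Q m \<union> ?g ` Sigma (?Q (Suc m)) (\<lambda>P. P)" (is "?L = ?R1 \<union> ?R2")
    proof (intro equalityI subsetI)
      fix P assume "P \<in> ?L"
      then have P: "partition_on (insert x A) P" "card P = Suc m" by auto
      have finP: "finite P" using P(2) card.infinite by fastforce
      obtain C where C: "C \<in> P" "x \<in> C" using P(1) by (auto simp: partition_on_def)
      have sep: "disjnt C (\<Union>(P - {C}))"
        using P(1) C(1) by (fastforce simp: partition_on_def disjoint_def disjnt_def)
      have PC: "P = insert C (P - {C})" using C by blast
      have rest: "partition_on (insert x A - C) (P - {C})" "C \<subseteq> insert x A"
        using P(1) PC partition_on_insert[OF sep, of "insert x A"] by simp_all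
      show "P \<in> ?R1 \<union> ?R2"
      proof (cases "C = {x}")
        case True
        have "insert x A - C = A" using True insert.hyps by simp
        then have "partition_on A (P - {C})" using rest by simp
        moreover have "card (P - {C}) = m" using P(2) C finP by simp
        moreover have "P = insert {x} (P - {C})" using PC True by simp
        ultimately show ?thesis by (intro UnI1 image_eqI[of _ _ "P - {C}"]) simp_all
      next
        case False
        define B where "B = C - {x}"
        have B: "B \<noteq> {}" "C = insert x B" "x \<notin> B" using False C by (auto simp: B_def)
        have sepB: "disjnt B (\<Union>(P - {C}))"
          using sep B(2) by (simp add: disjnt_insert1)
        then have BP: "B \<notin> P - {C}" using B(1) by (auto simp: disjnt_def)
        have "A - B = insert x A - C" "B \<subseteq> A" using B rest(2) insert.hyps by auto
        then have "partition_on A (insert B (P - {C}))"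
          using partition_on_insert[OF sepB, of A] rest(1) B(1) by simp
        moreover have "card (insert B (P - {C})) = Suc m"
          using P(2) C finP BP by (simp add: card_Suc_Diff1)
        moreover have "P = ?g (insert B (P - {C}), B)"
        proof -
          have "insert B (P - {C}) - {B} = P - {C}" using BP by (rule Diff_insert_absorb)
          then show ?thesis using PC B(2) by simp
        qed
        ultimately show ?thesis
          by (intro UnI2 image_eqI[of _ _ "(insert B (P - {C}), B)"]) simp_all
      qed
    next
      fix P assume "P \<in> ?R1 \<union> ?R2"
      then show "P \<in> ?L"
      proof
        assume "P \<in> ?R1"
        then obtain P' where P': "partition_on A P'" "card P' = m" "P = insert {x} P'" by auto
        have "{x} \<notin> P'" using nx[OF P'(1)] by blast
        then have "card P = Suc m" using P' fin by simp
        moreover have "disjnt {x} (\<Union>P')" using nx[OF P'(1)] by (auto simp: disjnt_def)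
        then have "partition_on (insert x A) P"
          using P' insert.hyps by (simp add: partition_on_insert)
        ultimately show ?thesis by simp
      next
        assume "P \<in> ?R2"
        then obtain P' B where P': "partition_on A P'" "card P' = Suc m" "B \<in> P'"
          "P = insert (insert x B) (P' - {B})" by auto
        have nxB: "insert x B \<notin> P' - {B}" using nx[OF P'(1)] by blast
        have "card P = Suc m"
          using P' fin[OF P'(1)] nxB by (simp add: card_Suc_Diff1)
        moreover have "partition_on (insert x A) P"
        proof -
          have sep: "disjnt B (\<Union>(P' - {B}))"
            using P'(1,3) by (fastforce simp: partition_on_def disjoint_def disjnt_def)
          have "P' = insert B (P' - {B})" using P'(3) by blast
          then have rest: "partition_on (A - B) (P' - {B})" "B \<subseteq> A"
            using P'(1) partition_on_insert[OF sep, of A] by simp_all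
          have "disjnt (insert x B) (\<Union>(P' - {B}))"
            using sep nx[OF P'(1)] by (auto simp: disjnt_insert1)
          moreover have "insert x A - insert x B = A - B" using insert.hyps by auto
          ultimately show ?thesis
            using P'(4) rest by (auto simp: partition_on_insert)
        qed
        ultimately show ?thesis by simp
      qed
    qed
    have disj: "?R1 \<inter> ?R2 = {}"
    proof -
      have "{x} \<notin> insert (insert x B) (P - {B})" if "partition_on A P" "B \<in> P" for P B
        using nx[OF that(1)] nA[OF that] nx[OF that] by auto
      then show ?thesis by fastforce
    qed
    have c1: "card ?R1 = card (?Q m)"
    proof (rule card_image)
      show "inj_on (insert {x}) (?Q m)"
      proof (rule inj_onI)
        fix P P' assume "P \<in> ?Q m" "P' \<in> ?Q m" and e: "insert {x} P = insert {x} P'"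
        then have "{x} \<notin> P" "{x} \<notin> P'" using nx by blast+
        then show "P = P'" using e by (metis insert_ident)
      qed
    qed
    have c2: "card ?R2 = card (Sigma (?Q (Suc m)) (\<lambda>P. P))"
    proof (rule card_image, rule inj_onI, clarify)
      fix P B P' B'
      assume P: "partition_on A P" "B \<in> P" and P': "partition_on A P'" "B' \<in> P'"
        and e: "insert (insert x B) (P - {B}) = insert (insert x B') (P' - {B'})"
      have "insert x B \<notin> P' - {B'}" "insert x B' \<notin> P - {B}"
        using nx[OF P(1)] nx[OF P'(1)] by auto
      then have i: "insert x B = insert x B'" using e by blast
      then have BB: "B = B'" using nx[OF P] nx[OF P'] by (metis insert_ident)
      have "P - {B} = P' - {B'}"
        using e i nx[OF P(1)] nx[OF P'(1)]
        by (metis Diff_iff insertI1 insert_ident)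
      then show "P = P' \<and> B = B'" using BB P P' by (metis insert_Diff)
    qed
    have "card (Sigma (?Q (Suc m)) (\<lambda>P. P)) = (\<Sum>P\<in>?Q (Suc m). card P)"
      using finQ fin by (intro card_SigmaI) auto
    also have "\<dots> = Suc m * card (?Q (Suc m))" by simp
    finally have c3: "card ?R2 = Suc m * card (?Q (Suc m))" using c2 by simp
    have "finite (Sigma (?Q (Suc m)) (\<lambda>P. P))"
      using finQ fin by (intro finite_SigmaI) auto
    then have "card (?R1 \<union> ?R2) = card ?R1 + card ?R2"
      using finQ disj by (intro card_Un_disjoint) auto
    then show ?thesis
      using insert c1 c3 Suc eq by simp
  qed
qed

definition Bell_poly :: "nat \<Rightarrow> int poly" where
  "Bell_poly n = (\<Sum>k\<le>n. monom (int (Stirling n k)) k)"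

definition complementary_Bell :: "nat \<Rightarrow> int" where
  "complementary_Bell n = poly (Bell_poly n) (- 1)"

lemma complementary_Bell_eq_sum:
  "complementary_Bell n = (\<Sum>k\<le>n. (- 1) ^ k * int (Stirling n k))"
  by (simp add: complementary_Bell_def Bell_poly_def poly_sum poly_monom mult.commute)

end

(*
Let L be the linear functional on polynomials with L(x^n) = f(n). Since L(x p(x)) = - L(p(x + 1)),
multiplication by u = x^2 - x - 1 acts under L like the difference p(x) -> p(x + 2) - p(x), which
is even. Filter the polynomials by giving u weight 1 and 2 weight 2; then the values of L on
polynomials of weight 2k are divisible by 2^k. As x^12 - 1 has weight 4, the Newton expansion
  f(r + 12 m) = sum_j (m choose j) L(x^r (x^12 - 1)^j)
has j-th coefficient divisible by 4^j. A Strassmann-type argument, in which divided differences of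
integer polynomials replace 2-adic analysis, shows that such a series attains a value c only
finitely often unless it is constant, which is excluded by comparing f(r) with f(r + 12).
*)

theory Submission
  imports Defs "HOL-Computational_Algebra.Primes"
begin

section \<open>Zeros of rapidly convergent 2-adic Newton series\<close>

text \<open>The weights are those of the divided difference with nodes \<open>S\<close>. Induction
  removes a node \<open>a\<close>: the quotient of \<open>P - P(a)\<close> by \<open>X - a\<close>
  is again an integer polynomial, which gives integrality, and its degree is one lower.\<close>

lemma divided_difference_weights:
  fixes S :: "int set"
  assumes "finite S" "card S = Suc s"
  shows "\<exists>w :: int \<Rightarrow> rat. \<forall>P :: int poly.
    (\<Sum>m\<in>S. w m * of_int (poly P m)) \<in> \<int> \<and>
    (degree P \<le> s \<longrightarrow> (\<Sum>m\<in>S. w m * of_int (poly P m)) = of_int (coeff P s))"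
  using assms
proof (induction s arbitrary: S)
  case 0
  then obtain a where S: "S = {a}" by (metis One_nat_def card_1_singletonE)
  have "poly P a = coeff P 0" if "degree P = 0" for P :: "int poly"
    using that by (auto elim!: degree_eq_zeroE)
  then show ?case unfolding S by (intro exI[of _ "\<lambda>_. 1"]) auto
next
  case (Suc s)
  then obtain a T where S: "S = insert a T" "a \<notin> T" "card T = Suc s"
    by (metis card_Suc_eq)
  have finT: "finite T" using Suc.prems S by simp
  obtain w :: "int \<Rightarrow> rat" where w: "\<And>P :: int poly. (\<Sum>m\<in>T. w m * of_int (poly P m)) \<in> \<int>"
    "\<And>P :: int poly. degree P \<le> s \<Longrightarrow> (\<Sum>m\<in>T. w m * of_int (poly P m)) = of_int (coeff P s)"
    using Suc.IH[OF finT S(3)] by blast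
  \<comment> \<open>The weight at \<open>a\<close> makes all weights sum to \<open>0\<close>, so
    that the constant \<open>poly P a\<close> drops out.\<close>
  define v where "v m = (if m = a then - (\<Sum>k\<in>T. w k / of_int (k - a)) else w m / of_int (m - a))" for m
  have red: "(\<Sum>m\<in>S. v m * of_int (poly P m)) = (\<Sum>m\<in>T. w m * of_int (poly (synthetic_div P a) m))" for P
  proof -
    have "w m * of_int (poly (synthetic_div P a) m)
        = w m / of_int (m - a) * of_int (poly P m) - w m / of_int (m - a) * of_int (poly P a)"
      if "m \<in> T" for m
    proof -
      define d :: rat where "d = of_int (m - a)"
      have "poly P m = (m - a) * poly (synthetic_div P a) m + poly P a"
        by (subst synthetic_div_correct'[of a P, symmetric]) (simp add: algebra_simps)
      then have "rat_of_int (poly P m) = d * of_int (poly (synthetic_div P a) m) + of_int (poly P a)"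
        by (simp add: d_def)
      moreover have "d \<noteq> 0" using that S(2) by (auto simp: d_def)
      ultimately show ?thesis unfolding d_def[symmetric] by (simp add: field_simps)
    qed
    then have "(\<Sum>m\<in>T. w m * of_int (poly (synthetic_div P a) m))
       = (\<Sum>m\<in>T. w m / of_int (m - a) * of_int (poly P m)) + v a * of_int (poly P a)"
      by (simp add: sum_subtractf sum_distrib_right v_def)
    also have "(\<Sum>m\<in>T. w m / of_int (m - a) * of_int (poly P m)) = (\<Sum>m\<in>T. v m * of_int (poly P m))"
      by (rule sum.cong) (use S(2) in \<open>auto simp: v_def\<close>)
    finally show ?thesis using S finT by (simp add: add.commute)
  qed
  have "coeff (synthetic_div P a) s = coeff P (Suc s)" if "degree P \<le> Suc s" for P
  proof -
    have "coeff P (Suc s) = coeff ([:-a, 1:] * synthetic_div P a + [:poly P a:]) (Suc s)"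
      by (simp only: synthetic_div_correct')
    also have "\<dots> = coeff (synthetic_div P a) s"
      using that by (simp add: coeff_eq_0 degree_synthetic_div)
    finally show ?thesis by simp
  qed
  then show ?case using w by (intro exI[of _ v]) (auto simp: red degree_synthetic_div)
qed

section \<open>Falling factorials and the 2-adic valuation of factorials\<close>

definition falling_factorial_poly :: "nat \<Rightarrow> int poly" where
  "falling_factorial_poly j = (\<Prod>i<j. [:- int i, 1:])"

lemma degree_falling_factorial_poly: "degree (falling_factorial_poly j) = j"
  unfolding falling_factorial_poly_def by (subst degree_prod_eq_sum_degree) auto

lemma coeff_falling_factorial_poly: "coeff (falling_factorial_poly j) j = 1"
proof -
  have "lead_coeff (falling_factorial_poly j) = 1"
    unfolding falling_factorial_poly_def by (simp add: lead_coeff_prod)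
  then show ?thesis by (simp add: degree_falling_factorial_poly)
qed

lemma poly_falling_factorial_poly:
  "poly (falling_factorial_poly j) (int m) = fact j * int (m choose j)"
proof -
  have "rat_of_int (fact j * int (m choose j)) = fact j * (rat_of_nat m gchoose j)"
    by (simp add: binomial_gbinomial)
  also have "\<dots> = (\<Prod>i<j. rat_of_nat m - rat_of_nat i)"
    by (simp add: gbinomial_mult_fact atLeast0LessThan)
  also have "\<dots> = rat_of_int (poly (falling_factorial_poly j) (int m))"
    by (simp add: falling_factorial_poly_def poly_prod)
  finally show ?thesis by (metis of_int_eq_iff)
qed

text \<open>Both \<open>(2n)!\<close> and \<open>(2n+1)!\<close> have valuation \<open>n\<close>
  plus that of \<open>n!\<close>, and the bound for \<open>n!\<close> gives at most
  \<open>2n\<close>. Together with \<open>4 ^ j dvd e j\<close> this leaves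
  \<open>e j / fact j\<close> with valuation at least \<open>j\<close>.\<close>

lemma multiplicity_2_fact_le: "multiplicity (2 :: int) (fact j) \<le> j"
proof (induction j rule: less_induct)
  case (less j)
  have rec: "multiplicity 2 (fact (Suc n) :: int)
      = multiplicity 2 (int (Suc n)) + multiplicity 2 (fact n :: int)" for n
    by (subst fact_Suc, subst prime_elem_multiplicity_mult_distrib) auto
  have odd: "multiplicity 2 (int (Suc (2 * n))) = 0" for n
    by (rule not_dvd_imp_multiplicity_0) simp
  have even: "multiplicity 2 (int (Suc (Suc (2 * n)))) = Suc (multiplicity 2 (int (Suc n)))" for n
  proof -
    have "int (Suc (Suc (2 * n))) = 2 * int (Suc n)" by simp
    then show ?thesis by (simp only:) (rule multiplicity_times_same, auto)
  qed
  have dbl: "multiplicity 2 (fact (2 * n) :: int) = n + multiplicity 2 (fact n :: int)" for n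
  proof (induction n)
    case (Suc n)
    have "2 * Suc n = Suc (Suc (2 * n))" by simp
    then show ?case by (simp only: rec odd even Suc.IH)
  qed simp
  define n where "n = j div 2"
  have "j = 2 * n \<or> j = Suc (2 * n)" by (auto simp: n_def)
  then have "multiplicity 2 (fact j :: int) = n + multiplicity 2 (fact n :: int)"
    by (elim disjE) (simp_all only: rec odd dbl add_0)
  moreover have "multiplicity 2 (fact n :: int) \<le> n"
    by (cases "j = 0") (use less.IH[of n] in \<open>auto simp: n_def\<close>)
  ultimately show ?case unfolding n_def by linarith
qed

text \<open>
  Let \<open>s\<close> be the last index where the 2-adic valuation of \<open>e j / fact j\<close> is minimal. The divided
  difference of the series over \<open>s + 1\<close> zeros is \<open>0\<close>, but it is also \<open>e s / fact s\<close> plus integer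
  multiples of later, 2-adically smaller terms. The factor \<open>fact J\<close> below clears denominators.
\<close>

lemma finite_zeros_Newton_series:
  fixes e :: "nat \<Rightarrow> int"
  assumes dvd: "\<And>j. 4 ^ j dvd e j" and nz: "e i \<noteq> 0"
  shows "finite {m. (\<Sum>j\<le>m. int (m choose j) * e j) = 0}"
proof (rule ccontr)
  assume inf: "infinite {m. (\<Sum>j\<le>m. int (m choose j) * e j) = 0}"
  define v where "v = multiplicity (2 :: int)"
  have vmult: "v (x * y) = v x + v y" if "x \<noteq> 0" "y \<noteq> 0" for x y
    unfolding v_def using that by (intro prime_elem_multiplicity_mult_distrib) auto
  have ve: "v (e j) \<ge> j + v (fact j)" if "e j \<noteq> 0" for j
  proof -
    have "(2 :: int) ^ (2 * j) dvd e j" using dvd[of j] by (simp add: power_mult)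
    then have "2 * j \<le> v (e j)" unfolding v_def using that by (intro multiplicity_geI) auto
    then show ?thesis using multiplicity_2_fact_le[of j] by (simp add: v_def)
  qed
  \<comment> \<open>By \<open>ve\<close> this truncated subtraction is exact whenever
    \<open>e j\<close> is nonzero; it is then the valuation of \<open>e j / fact j\<close>.\<close>
  define \<nu> where "\<nu> j = v (e j) - v (fact j)" for j
  define \<mu> where "\<mu> = (LEAST k. \<exists>j. e j \<noteq> 0 \<and> \<nu> j = k)"
  have ex: "\<exists>j. e j \<noteq> 0 \<and> \<nu> j = \<mu>"
    unfolding \<mu>_def by (rule LeastI[of _ "\<nu> i"]) (use nz in blast)
  have min: "\<mu> \<le> \<nu> j" if "e j \<noteq> 0" for j
    unfolding \<mu>_def by (rule Least_le) (use that in blast)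
  define A where "A = {j. e j \<noteq> 0 \<and> \<nu> j = \<mu>}"
  \<comment> \<open>For nonzero \<open>e j\<close>, \<open>ve\<close> gives
    \<open>j \<le> \<nu> j\<close>, so the minimum is attained only finitely often and a last index
    exists.\<close>
  have "A \<subseteq> {..\<mu>}"
    using ve by (force simp: A_def \<nu>_def)
  then have finA: "finite A" by (rule finite_subset) simp
  define s where "s = Max A"
  have sA: "s \<in> A" unfolding s_def using finA ex by (intro Max_in) (auto simp: A_def)
  have gt: "\<mu> < \<nu> j" if "e j \<noteq> 0" "j > s" for j
  proof -
    have "j \<notin> A" using that(2) Max_ge[OF finA, of j] unfolding s_def by linarith
    then show ?thesis using min[OF that(1)] that(1) by (auto simp: A_def)
  qed
  obtain S where S: "finite S" "card S = Suc s" "S \<subseteq> {m. (\<Sum>j\<le>m. int (m choose j) * e j) = 0}"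
    using infinite_arbitrarily_large[OF inf] by blast
  have "finite (int ` S)" "card (int ` S) = Suc s"
    using S by (auto simp: card_image)
  from divided_difference_weights[OF this]
  obtain w :: "int \<Rightarrow> rat" where w: "\<And>P :: int poly. (\<Sum>m\<in>int ` S. w m * of_int (poly P m)) \<in> \<int>"
    "\<And>P :: int poly. degree P \<le> s \<Longrightarrow> (\<Sum>m\<in>int ` S. w m * of_int (poly P m)) = of_int (coeff P s)"
    by blast
  define D where "D P = (\<Sum>m\<in>S. w (int m) * of_int (poly P (int m)))" for P
  have D_alt: "D P = (\<Sum>m\<in>int ` S. w m * of_int (poly P m))" for P
    unfolding D_def by (subst sum.reindex) (auto simp: o_def)
  have "\<forall>j. \<exists>z. D (falling_factorial_poly j) = of_int z"
    using w(1) unfolding D_alt by (meson Ints_cases)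
  then obtain z where z: "\<And>j. D (falling_factorial_poly j) = of_int (z j)"
    by metis
  \<comment> \<open>A divided difference over \<open>s + 1\<close> nodes kills degrees below
    \<open>s\<close> and maps a monic polynomial of degree \<open>s\<close> to
    \<open>1\<close>.\<close>
  have z_lt: "z j = 0" if "j < s" for j
  proof -
    have "of_int (z j) = (0 :: rat)" unfolding z[symmetric] D_alt
      using that by (subst w(2)) (auto simp: degree_falling_factorial_poly coeff_eq_0)
    then show ?thesis by simp
  qed
  have z_s: "z s = 1"
  proof -
    have "of_int (z s) = (1 :: rat)" unfolding z[symmetric] D_alt
      by (subst w(2)) (auto simp: degree_falling_factorial_poly coeff_falling_factorial_poly)
    then show ?thesis by simp
  qed
  \<comment> \<open>All chosen zeros \<open>m\<close> are at most \<open>J\<close>, so their series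
    may be summed up to \<open>J\<close>: \<open>m choose j\<close> is \<open>0\<close> for
    \<open>j > m\<close>.\<close>
  define J where "J = Max (insert s S)"
  have J: "s \<le> J" "\<And>m. m \<in> S \<Longrightarrow> m \<le> J" using S(1) by (auto simp: J_def)
  define b where "b j = (fact J div fact j) * e j" for j
  have fJ: "fact J = (fact J div fact j) * (fact j :: int)" if "j \<le> J" for j
    using that by (simp add: fact_dvd)
  have vanish: "(\<Sum>j\<le>J. b j * poly (falling_factorial_poly j) (int m)) = 0" if "m \<in> S" for m
  proof -
    have "(\<Sum>j\<le>J. b j * poly (falling_factorial_poly j) (int m))
        = (\<Sum>j\<le>J. fact J * (int (m choose j) * e j))"
    proof (rule sum.cong)
      fix j assume "j \<in> {..J}"
      then show "b j * poly (falling_factorial_poly j) (int m) = fact J * (int (m choose j) * e j)"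
        using fJ[of j] by (subst fJ[of j]) (auto simp: b_def poly_falling_factorial_poly)
    qed simp
    also have "\<dots> = fact J * (\<Sum>j\<le>J. int (m choose j) * e j)"
      by (simp add: sum_distrib_left)
    also have "(\<Sum>j\<le>J. int (m choose j) * e j) = (\<Sum>j\<le>m. int (m choose j) * e j)"
      using J(2)[OF that] by (intro sum.mono_neutral_right) auto
    also have "\<dots> = 0" using that S(3) by auto
    finally show ?thesis by simp
  qed
  \<comment> \<open>The divided difference of the combination of falling factorials with
    coefficients \<open>b j\<close> is computed termwise and through its values, which vanish on
    \<open>S\<close>.\<close>
  have "rat_of_int (\<Sum>j\<le>J. b j * z j) = (\<Sum>j\<le>J. of_int (b j) * D (falling_factorial_poly j))"
    by (simp add: z)
  also have "\<dots> = (\<Sum>m\<in>S. w (int m) * of_int (\<Sum>j\<le>J. b j * poly (falling_factorial_poly j) (int m)))"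
    unfolding D_def sum_distrib_left of_int_sum by (subst sum.swap) (simp add: mult_ac)
  also have "\<dots> = 0" by (rule sum.neutral) (use vanish in simp)
  finally have "(\<Sum>j\<le>J. b j * z j) = 0" by (metis of_int_eq_0_iff)
  moreover have "(\<Sum>j\<le>J. b j * z j) = b s * z s + (\<Sum>j\<in>{..J} - {s}. b j * z j)"
    using J(1) by (intro sum.remove) auto
  ultimately have eq: "b s = - (\<Sum>j\<in>{..J} - {s}. b j * z j)" using z_s by simp
  have vb: "v (b j) = v (fact J) + \<nu> j" if "e j \<noteq> 0" "j \<le> J" for j
  proof -
    have "fact J div fact j \<noteq> (0 :: int)" using fJ[OF that(2)] by (metis fact_nonzero mult_zero_left)
    then have "v (fact J) = v (fact J div fact j) + v (fact j)" "v (b j) = v (fact J div fact j) + v (e j)"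
      using fJ[OF that(2)] vmult[of "fact J div fact j" "fact j"] that(1) by (auto simp: b_def vmult)
    then show ?thesis using ve[OF that(1)] by (simp add: \<nu>_def)
  qed
  have "2 ^ Suc (v (b s)) dvd b j * z j" if "j \<in> {..J} - {s}" for j
  proof (cases "j < s \<or> e j = 0")
    case True
    then show ?thesis using z_lt by (auto simp: b_def)
  next
    case False
    then have j: "j > s" "e j \<noteq> 0" "j \<le> J" using that by auto
    have "Suc (v (b s)) \<le> v (b j)"
      using vb[of s] vb[of j] gt[of j] j sA J(1) by (auto simp: A_def)
    then have "2 ^ Suc (v (b s)) dvd b j"
      unfolding v_def using multiplicity_dvd' by blast
    then show ?thesis by simp
  qed
  then have "2 ^ Suc (v (b s)) dvd b s"
    by (subst (2) eq) (auto intro!: dvd_sum)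
  moreover have "b s \<noteq> 0"
    using sA fJ[OF J(1)] by (auto simp: b_def A_def)
  ultimately have "Suc (v (b s)) \<le> v (b s)"
    unfolding v_def by (intro multiplicity_geI) auto
  then show False by simp
qed

section \<open>The umbral functional\<close>

definition umbral :: "int poly \<Rightarrow> int" where
  "umbral p = (\<Sum>i\<le>degree p. coeff p i * complementary_Bell i)"

lemma umbral_altdef:
  assumes "degree p \<le> n"
  shows "umbral p = (\<Sum>i\<le>n. coeff p i * complementary_Bell i)"
  unfolding umbral_def using assms
  by (intro sum.mono_neutral_left) (auto simp: coeff_eq_0)

lemma umbral_0 [simp]: "umbral 0 = 0"
  by (simp add: umbral_def)

lemma umbral_add: "umbral (p + q) = umbral p + umbral q"
proof -
  define n where "n = max (degree p) (degree q)"
  have "degree p \<le> n" "degree q \<le> n" "degree (p + q) \<le> n"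
    using degree_add_le_max[of p q] by (auto simp: n_def)
  then show ?thesis
    by (simp add: umbral_altdef[of _ n] sum.distrib algebra_simps)
qed

lemma umbral_smult: "umbral (smult c p) = c * umbral p"
proof -
  have "degree (smult c p) \<le> degree p" by (rule degree_smult_le)
  then show ?thesis
    by (simp add: umbral_altdef[of _ "degree p"] sum_distrib_left algebra_simps)
qed

lemma umbral_uminus: "umbral (- p) = - umbral p"
  using umbral_smult[of "-1" p] by simp

lemma umbral_diff: "umbral (p - q) = umbral p - umbral q"
  using umbral_add[of p "- q"] by (simp add: umbral_uminus)

lemma umbral_sum: "umbral (\<Sum>i\<in>A. p i) = (\<Sum>i\<in>A. umbral (p i))"
  by (induction A rule: infinite_finite_induct) (auto simp: umbral_add)

lemma umbral_monom: "umbral (monom c n) = c * complementary_Bell n"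
proof -
  have "umbral (monom c n) = (\<Sum>i\<le>n. if i = n then c * complementary_Bell n else 0)"
    unfolding umbral_altdef[OF degree_monom_le] by (rule sum.cong) auto
  then show ?thesis by simp
qed

text \<open>Combinatorially, \<open>i\<close> counts the elements outside the block of one fixed
  element. The proof is an induction on \<open>n\<close> with Pascal's rule.\<close>

lemma Stirling_Suc_Suc_eq_sum:
  "Stirling (Suc n) (Suc k) = (\<Sum>i\<le>n. (n choose i) * Stirling i k)"
proof (induction n arbitrary: k)
  case 0
  show ?case by (cases k) auto
next
  case (Suc n)
  have split: "(\<Sum>i\<le>Suc n. (Suc n choose i) * Stirling i k)
      = (\<Sum>i\<le>n. (n choose i) * Stirling i k) + (\<Sum>i\<le>n. (n choose i) * Stirling (Suc i) k)"
  proof -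
    have "(\<Sum>i\<le>Suc n. (Suc n choose i) * Stirling i k)
        = Stirling 0 k + (\<Sum>i\<le>n. (Suc n choose Suc i) * Stirling (Suc i) k)"
      by (subst sum.atMost_Suc_shift) simp
    also have "\<dots> = (Stirling 0 k + (\<Sum>i\<le>n. (n choose Suc i) * Stirling (Suc i) k))
        + (\<Sum>i\<le>n. (n choose i) * Stirling (Suc i) k)"
      by (simp add: sum.distrib algebra_simps)
    also have "Stirling 0 k + (\<Sum>i\<le>n. (n choose Suc i) * Stirling (Suc i) k)
        = (\<Sum>i\<le>Suc n. (n choose i) * Stirling i k)"
      by (subst sum.atMost_Suc_shift) simp
    also have "\<dots> = (\<Sum>i\<le>n. (n choose i) * Stirling i k)" by simp
    finally show ?thesis .
  qed
  show ?case
  proof (cases k)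
    case 0
    then show ?thesis unfolding split using Suc.IH[of 0] by simp
  next
    case (Suc k')
    have "(\<Sum>i\<le>n. (n choose i) * Stirling (Suc i) k)
        = k * (\<Sum>i\<le>n. (n choose i) * Stirling i k) + (\<Sum>i\<le>n. (n choose i) * Stirling i k')"
      unfolding Suc by (simp add: sum.distrib sum_distrib_left algebra_simps)
    also have "\<dots> = k * Stirling (Suc n) (Suc k) + Stirling (Suc n) k"
      unfolding Suc Suc.IH ..
    finally show ?thesis unfolding split using Suc.IH[of k] by simp
  qed
qed

lemma complementary_Bell_Suc:
  "complementary_Bell (Suc n) = - (\<Sum>i\<le>n. int (n choose i) * complementary_Bell i)"
proof -
  \<comment> \<open>A common range for \<open>k\<close> allows the two sums to be exchanged;
    \<open>Stirling i k\<close> is \<open>0\<close> for \<open>k > i\<close>.\<close>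
  have ext: "complementary_Bell i = (\<Sum>k\<le>n. (- 1) ^ k * int (Stirling i k))" if "i \<le> n" for i
    unfolding complementary_Bell_eq_sum using that by (intro sum.mono_neutral_left) auto
  have "complementary_Bell (Suc n) = - (\<Sum>k\<le>n. (- 1) ^ k * int (Stirling (Suc n) (Suc k)))"
    unfolding complementary_Bell_eq_sum by (subst sum.atMost_Suc_shift) (simp add: sum_negf)
  also have "(\<Sum>k\<le>n. (- 1) ^ k * int (Stirling (Suc n) (Suc k)))
      = (\<Sum>k\<le>n. \<Sum>i\<le>n. int (n choose i) * ((- 1) ^ k * int (Stirling i k)))"
    unfolding Stirling_Suc_Suc_eq_sum by (simp add: sum_distrib_left mult_ac)
  also have "\<dots> = (\<Sum>i\<le>n. int (n choose i) * complementary_Bell i)"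
    by (subst sum.swap) (simp add: ext sum_distrib_left)
  finally show ?thesis .
qed

lemma pcompose_monom: "monom c n \<circ>\<^sub>p q = smult c (q ^ n)"
  by (induction n) (simp_all add: monom_0 monom_Suc pcompose_pCons)

text \<open>On monomials this is \<open>complementary_Bell_Suc\<close> read through the binomial
  theorem; linearity does the rest.\<close>

lemma umbral_pCons_0: "umbral (pCons 0 p) = - umbral (p \<circ>\<^sub>p [:1, 1:])"
proof -
  have mon: "umbral (pCons 0 (monom c n)) = - umbral (monom c n \<circ>\<^sub>p [:1, 1:])" for c n
  proof -
    have "umbral ([:1, 1:] ^ n) = (\<Sum>i\<le>n. int (n choose i) * complementary_Bell i)"
      by (simp add: umbral_altdef[of _ n] degree_linear_power coeff_linear_poly_power)
    then have "umbral (monom c n \<circ>\<^sub>p [:1, 1:]) = - (c * complementary_Bell (Suc n))"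
      by (simp add: pcompose_monom umbral_smult complementary_Bell_Suc)
    then show ?thesis by (simp add: monom_Suc[symmetric] umbral_monom)
  qed
  define P where "P i = monom (coeff p i) i" for i
  have p: "p = (\<Sum>i\<le>degree p. P i)" by (simp add: P_def poly_as_sum_of_monoms)
  have "pCons 0 p = [:0, 1:] * p" by simp
  also have "\<dots> = [:0, 1:] * (\<Sum>i\<le>degree p. P i)" by (rule arg_cong[OF p])
  also have "\<dots> = (\<Sum>i\<le>degree p. [:0, 1:] * P i)" by (rule sum_distrib_left)
  also have "\<dots> = (\<Sum>i\<le>degree p. pCons 0 (P i))" by simp
  finally have "pCons 0 p = (\<Sum>i\<le>degree p. pCons 0 (P i))" .
  moreover have "p \<circ>\<^sub>p [:1, 1:] = (\<Sum>i\<le>degree p. P i \<circ>\<^sub>p [:1, 1:])"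
    by (subst (1) p) (simp add: pcompose_sum)
  ultimately show ?thesis by (simp add: umbral_sum mon P_def sum_negf)
qed

definition \<Delta>\<^sub>2 :: "int poly \<Rightarrow> int poly" where
  "\<Delta>\<^sub>2 p = p \<circ>\<^sub>p [:2, 1:] - p"

abbreviation quad :: "int poly" where
  "quad \<equiv> [:- 1, - 1, 1:]"

text \<open>Since \<open>quad = X (X - 1) - 1\<close>, the shift rule applies twice: removing
  \<open>X\<close> turns \<open>X - 1\<close> into \<open>X\<close>, which is removed in turn, and
  the two signs cancel.\<close>

lemma umbral_quad_mult: "umbral (quad * p) = umbral (\<Delta>\<^sub>2 p)"
proof -
  have "umbral (pCons 0 ([:- 1, 1:] * p)) = - umbral ([:0, 1:] * (p \<circ>\<^sub>p [:1, 1:]))"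
    unfolding umbral_pCons_0 pcompose_mult by (simp add: pcompose_pCons)
  also have "[:0, 1:] * (p \<circ>\<^sub>p [:1, 1:]) = pCons 0 (p \<circ>\<^sub>p [:1, 1:])" by simp
  also have "- umbral \<dots> = umbral ((p \<circ>\<^sub>p [:1, 1:]) \<circ>\<^sub>p [:1, 1:])"
    by (simp add: umbral_pCons_0)
  also have "(p \<circ>\<^sub>p [:1, 1:]) \<circ>\<^sub>p [:1, 1:] = p \<circ>\<^sub>p [:2, 1:]"
    by (simp add: pcompose_assoc[symmetric] pcompose_pCons)
  finally have "umbral (pCons 0 ([:- 1, 1:] * p)) = umbral (p \<circ>\<^sub>p [:2, 1:])" .
  moreover have "quad * p = pCons 0 ([:- 1, 1:] * p) - p"
    by (simp add: algebra_simps)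
  ultimately show ?thesis by (simp add: umbral_diff \<Delta>\<^sub>2_def)
qed

section \<open>A filtration of the polynomials\<close>

text \<open>
  \<open>filt k\<close> is the ideal generated by the \<open>2 ^ a * quad ^ b\<close> with \<open>2 * a + b \<ge> k\<close>. Truncated
  subtraction in \<open>k - 1\<close> is intended: \<open>2\<close> has weight at least \<open>1\<close>.
\<close>

fun filt :: "nat \<Rightarrow> int poly set" where
  "filt 0 = UNIV"
| "filt (Suc k) = {2 * a + quad * b | a b. a \<in> filt (k - 1) \<and> b \<in> filt k}"

lemma filt_SucI: "a \<in> filt (k - 1) \<Longrightarrow> b \<in> filt k \<Longrightarrow> 2 * a + quad * b \<in> filt (Suc k)"
  by auto

lemma filt_SucE:
  assumes "p \<in> filt (Suc k)"
  obtains a b where "a \<in> filt (k - 1)" "b \<in> filt k" "p = 2 * a + quad * b"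
  using assms by auto

declare filt.simps(2) [simp del]

lemma filt_add: "p \<in> filt k \<Longrightarrow> q \<in> filt k \<Longrightarrow> p + q \<in> filt k"
proof (induction k arbitrary: p q rule: filt.induct)
  case (2 k)
  obtain a b where p: "a \<in> filt (k - 1)" "b \<in> filt k" "p = 2 * a + quad * b"
    using 2(3) by (rule filt_SucE)
  obtain c d where q: "c \<in> filt (k - 1)" "d \<in> filt k" "q = 2 * c + quad * d"
    using 2(4) by (rule filt_SucE)
  have "p + q = 2 * (a + c) + quad * (b + d)"
    unfolding p q by (simp only: algebra_simps)
  then show ?case using 2(1,2) p q by (metis filt_SucI)
qed simp

lemma filt_mult_left: "p \<in> filt k \<Longrightarrow> g * p \<in> filt k"
proof (induction k arbitrary: p rule: filt.induct)
  case (2 k)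
  obtain a b where p: "a \<in> filt (k - 1)" "b \<in> filt k" "p = 2 * a + quad * b"
    using 2(3) by (rule filt_SucE)
  have "g * p = 2 * (g * a) + quad * (g * b)"
    unfolding p by (simp only: algebra_simps)
  then show ?case using 2(1,2) p by (metis filt_SucI)
qed simp

lemma filt_0 [simp]: "0 \<in> filt k"
proof (induction k rule: filt.induct)
  case (2 k)
  then show ?case using filt_SucI[of 0 k 0] by simp
qed simp

lemma filt_two_mult: "p \<in> filt (k - 2) \<Longrightarrow> 2 * p \<in> filt k"
  using filt_SucI[of p "k - 1" 0] by (cases k) (auto simp: numeral_2_eq_2)

lemma filt_quad_mult: "p \<in> filt (k - 1) \<Longrightarrow> quad * p \<in> filt k"
  using filt_SucI[of 0 "k - 1" p] by (cases k) auto

lemma filt_Suc_subset: "p \<in> filt (Suc k) \<Longrightarrow> p \<in> filt k"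
proof (induction k arbitrary: p rule: less_induct)
  case (less k)
  obtain a b where p: "a \<in> filt (k - 1)" "b \<in> filt k" "p = 2 * a + quad * b"
    using less.prems by (rule filt_SucE)
  \<comment> \<open>The hypothesis is needed at \<open>k - 2\<close>, hence the strong induction;
    for \<open>k \<le> 1\<close> the target is \<open>filt 0\<close>, which is everything.\<close>
  have "a \<in> filt (k - 2)"
  proof (cases "k \<le> 1")
    case False
    then have "k - 1 = Suc (k - 2)" "k - 2 < k" by auto
    then show ?thesis using less.IH[of "k - 2" a] p(1) by simp
  qed simp
  then show ?case
    unfolding p(3) using p(2) by (intro filt_add filt_two_mult filt_mult_left)
qed

lemma filt_antimono: "j \<le> k \<Longrightarrow> p \<in> filt k \<Longrightarrow> p \<in> filt j"
  by (induction k rule: dec_induct) (auto dest: filt_Suc_subset)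

lemma filt_mult: "p \<in> filt j \<Longrightarrow> q \<in> filt k \<Longrightarrow> p * q \<in> filt (j + k)"
proof (induction j arbitrary: p rule: filt.induct)
  case 1
  then show ?case by (simp add: filt_mult_left)
next
  case (2 j)
  obtain a b where p: "a \<in> filt (j - 1)" "b \<in> filt j" "p = 2 * a + quad * b"
    using 2(3) by (rule filt_SucE)
  have "a * q \<in> filt (j - 1 + k)" using 2 p by blast
  \<comment> \<open>For \<open>j = 0\<close> truncation makes the known index \<open>k\<close>
    larger than the required \<open>k - 1\<close>; otherwise the two agree.\<close>
  then have "a * q \<in> filt (j + k - 1)" by (rule filt_antimono[rotated]) simp
  moreover have "b * q \<in> filt (j + k)" using 2 p by blast
  moreover have "p * q = 2 * (a * q) + quad * (b * q)"
    unfolding p by (simp only: algebra_simps)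
  ultimately show ?case using filt_SucI by (metis add_Suc)
qed

lemma filt_power: "p \<in> filt k \<Longrightarrow> p ^ j \<in> filt (k * j)"
proof (induction j)
  case (Suc j)
  then show ?case using filt_mult[of p k "p ^ j" "k * j"] by simp
qed simp

text \<open>\<open>X + 2\<close> and \<open>X\<close> agree modulo \<open>2\<close>, hence so do
  \<open>p(X + 2)\<close> and \<open>p(X)\<close>.\<close>

lemma even_\<Delta>\<^sub>2: "\<exists>q. \<Delta>\<^sub>2 p = 2 * q"
proof (induction p)
  case (pCons a p)
  then obtain q where q: "p \<circ>\<^sub>p [:2, 1:] = p + 2 * q" by (auto simp: \<Delta>\<^sub>2_def algebra_simps)
  have "\<Delta>\<^sub>2 (pCons a p) = 2 * (p + 2 * q + pCons 0 q)"
  proof -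
    have "\<Delta>\<^sub>2 (pCons a p) = [:a:] + [:2, 1:] * (p + 2 * q) - pCons a p"
      by (simp only: \<Delta>\<^sub>2_def pcompose_pCons q)
    also have "pCons a p = [:a:] + [:0, 1:] * p" by simp
    also have "[:2, 1:] = 2 + [:0, 1 :: int:]" by (simp add: numeral_poly)
    also have "[:a:] + (2 + [:0, 1:]) * (p + 2 * q) - ([:a:] + [:0, 1:] * p)
        = 2 * (p + 2 * q + [:0, 1:] * q)"
      by (simp only: algebra_simps)
    finally show ?thesis by simp
  qed
  then show ?case ..
qed (auto simp: \<Delta>\<^sub>2_def intro: exI[of _ 0])

text \<open>The shift by \<open>2\<close> changes \<open>quad\<close> by
  \<open>2 * (2 X + 1)\<close>. By the product rule, halving the difference costs at most one unit
  of weight, although \<open>2\<close> itself has weight two.\<close>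

lemma filt_\<Delta>\<^sub>2: "p \<in> filt k \<Longrightarrow> \<exists>q\<in>filt (k - 1). \<Delta>\<^sub>2 p = 2 * q"
proof (induction k arbitrary: p rule: filt.induct)
  case 1
  then show ?case using even_\<Delta>\<^sub>2 by simp
next
  case (2 k)
  obtain a b where p: "a \<in> filt (k - 1)" "b \<in> filt k" "p = 2 * a + quad * b"
    using 2(3) by (rule filt_SucE)
  obtain a' where a': "a' \<in> filt (k - 1 - 1)" "\<Delta>\<^sub>2 a = 2 * a'" using 2(1) p by blast
  obtain b' where b': "b' \<in> filt (k - 1)" "\<Delta>\<^sub>2 b = 2 * b'" using 2(2) p by blast
  have "\<Delta>\<^sub>2 p = 2 * (2 * a' + (quad * b' + [:1, 2:] * (b + 2 * b')))"
  proof -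
    have b2: "b \<circ>\<^sub>p [:2, 1:] = b + 2 * b'" and a2: "a \<circ>\<^sub>p [:2, 1:] = a + 2 * a'"
      using a'(2) b'(2) by (auto simp: \<Delta>\<^sub>2_def algebra_simps)
    have two: "(2 :: int poly) \<circ>\<^sub>p [:2, 1:] = 2" by (simp add: numeral_poly)
    have u2: "quad \<circ>\<^sub>p [:2, 1:] = quad + 2 * [:1, 2:]"
      by (simp add: pcompose_pCons numeral_poly)
    have "\<Delta>\<^sub>2 p = 2 * (a + 2 * a') + (quad + 2 * [:1, 2:]) * (b + 2 * b') - (2 * a + quad * b)"
      unfolding \<Delta>\<^sub>2_def p(3) pcompose_add pcompose_mult a2 b2 u2 two ..
    then show ?thesis by (simp only: algebra_simps)
  qed
  moreover have "2 * a' + (quad * b' + [:1, 2:] * (b + 2 * b')) \<in> filt k"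
  proof (rule filt_add[OF _ filt_add[OF _ filt_mult_left[OF filt_add]]])
    show "2 * a' \<in> filt k" using a'(1) by (intro filt_two_mult) (simp add: numeral_2_eq_2)
    show "quad * b' \<in> filt k" using b'(1) by (rule filt_quad_mult)
    show "b \<in> filt k" by (rule p(2))
    show "2 * b' \<in> filt k"
      by (intro filt_two_mult filt_antimono[OF _ b'(1)]) simp
  qed
  ultimately show ?case by (simp only: diff_Suc_1) blast
qed

text \<open>Two units of weight yield one factor \<open>2\<close>: in
  \<open>2 * a + quad * b\<close> it is explicit in the first term, and in the second it comes from
  replacing \<open>quad * b\<close> by \<open>\<Delta>\<^sub>2 b\<close>.\<close>

lemma umbral_filt_dvd: "p \<in> filt (2 * k) \<Longrightarrow> 2 ^ k dvd umbral p"
proof (induction k arbitrary: p)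
  case (Suc k)
  obtain a b where p: "a \<in> filt (2 * k)" "b \<in> filt (Suc (2 * k))" "p = 2 * a + quad * b"
  proof (rule filt_SucE)
    show "p \<in> filt (Suc (Suc (2 * k)))" using Suc.prems by simp
  qed simp
  obtain c where c: "c \<in> filt (2 * k)" "\<Delta>\<^sub>2 b = 2 * c"
    using filt_\<Delta>\<^sub>2[OF p(2)] unfolding diff_Suc_1 by blast
  have two: "umbral (2 * q) = 2 * umbral q" for q
    using umbral_add[of q q] by (simp only: mult_2)
  have "umbral p = 2 * (umbral a + umbral c)"
    unfolding p(3) umbral_add umbral_quad_mult c(2) two distrib_left ..
  then show ?case
    using Suc.IH[OF p(1)] Suc.IH[OF c(1)] by (simp only: power_Suc mult_dvd_mono dvd_add dvd_refl)
qed simp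

text \<open>Squaring sends \<open>1 + p\<close> to \<open>1 + (p * p + 2 * p)\<close>, which raises
  a weight \<open>k\<close> to the smaller of \<open>2 * k\<close> and \<open>k + 2\<close>. The
  exponents 3, 6, 12 thus reach weights 1, 2, 4.\<close>

lemma X_power_12_minus_1_in_filt: "monom 1 12 - 1 \<in> filt 4"
proof -
  have dbl: "(p + 1)\<^sup>2 - 1 \<in> filt l" if "p \<in> filt k" "l \<le> 2 * k" "l \<le> k + 2" for p k l
  proof -
    have "(p + 1)\<^sup>2 - 1 = p * p + 2 * p" by (simp add: power2_eq_square algebra_simps)
    moreover have "p * p \<in> filt l"
      using that by (intro filt_antimono[OF _ filt_mult[of p k p k]]) simp_all
    moreover have "2 * p \<in> filt l"
      using that by (intro filt_antimono[OF _ filt_two_mult[of p "k + 2"]]) simp_all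
    ultimately show ?thesis by (simp add: filt_add)
  qed
  \<comment> \<open>Modulo \<open>2\<close>, \<open>quad\<close> is \<open>X^2 + X + 1\<close>, a
    factor of \<open>X^3 - 1\<close>.\<close>
  have "monom 1 3 - 1 = 2 * [:- 1, 0, 1:] + quad * [:- 1, 1 :: int:]"
    by (simp add: monom_altdef numeral_poly one_pCons power3_eq_cube)
  then have "monom 1 3 - 1 \<in> filt 1"
    by (simp only: One_nat_def) (rule filt_SucI, simp_all)
  from dbl[OF this, of 2] have "monom 1 6 - 1 \<in> filt 2"
    by (simp add: monom_power)
  from dbl[OF this, of 4] show ?thesis by (simp add: monom_power)
qed

section \<open>Finiteness of the fibers\<close>

definition Newton_coeff :: "nat \<Rightarrow> nat \<Rightarrow> int" where
  "Newton_coeff r j = umbral (monom 1 r * (monom 1 12 - 1) ^ j)"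

lemma Newton_coeff_dvd: "4 ^ j dvd Newton_coeff r j"
proof -
  have "monom 1 r * (monom 1 12 - 1) ^ j \<in> filt (2 * (2 * j))"
    using filt_power[OF X_power_12_minus_1_in_filt, of j] by (intro filt_mult_left) simp
  from umbral_filt_dvd[OF this] show ?thesis
    by (simp add: Newton_coeff_def power_mult)
qed

lemma complementary_Bell_Newton:
  "complementary_Bell (r + 12 * m) = (\<Sum>j\<le>m. int (m choose j) * Newton_coeff r j)"
proof -
  have "monom 1 (r + 12 * m) = monom 1 r * ((monom 1 12 - 1) + 1 :: int poly) ^ m"
    by (simp add: monom_power mult_monom)
  also have "\<dots> = (\<Sum>j\<le>m. smult (int (m choose j)) (monom 1 r * (monom 1 12 - 1) ^ j))"
    by (subst binomial_ring) (simp add: sum_distrib_left mult_ac of_nat_poly)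
  finally show ?thesis
    using umbral_monom[of 1 "r + 12 * m"] by (simp add: umbral_sum umbral_smult Newton_coeff_def)
qed

section \<open>Evaluation of complementary Bell numbers by rows of Stirling numbers\<close>

lemma Bell_poly_0: "Bell_poly 0 = 1"
  by (simp add: Bell_poly_def)

lemma Bell_poly_Suc: "Bell_poly (Suc n) = pCons 0 (Bell_poly n + pderiv (Bell_poly n))"
proof (rule poly_eqI)
  have c: "coeff (Bell_poly n) k = int (Stirling n k)" for n k
    by (auto simp: Bell_poly_def coeff_sum)
  fix k
  show "coeff (Bell_poly (Suc n)) k = coeff (pCons 0 (Bell_poly n + pderiv (Bell_poly n))) k"
    by (cases k) (auto simp: c coeff_pderiv algebra_simps)
qed

text \<open>
  \<open>Bell_row_step 0 0\<close> maps a row of Stirling numbers to the next one; \<open>a\<close> carries the previous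
  entry and \<open>k\<close> the current column.
\<close>

primrec Bell_row_step :: "int \<Rightarrow> int \<Rightarrow> int list \<Rightarrow> int list" where
  "Bell_row_step a k [] = [a]"
| "Bell_row_step a k (x # xs) = (a + k * x) # Bell_row_step x (k + 1) xs"

primrec alternating_sum :: "int list \<Rightarrow> int" where
  "alternating_sum [] = 0"
| "alternating_sum (x # xs) = x - alternating_sum xs"

text \<open>For \<open>a = k = 0\<close> the right-hand side is the recurrence
  \<open>Bell_poly_Suc\<close>. Both parameters are general because they change along the
  row.\<close>

lemma Poly_Bell_row_step:
  "Poly (Bell_row_step a k xs)
    = [:a:] + smult k (Poly xs) + pCons 0 (Poly xs + pderiv (Poly xs))"
  by (induction xs arbitrary: a k) (simp_all add: pderiv_pCons algebra_simps smult_add_left)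

lemma alternating_sum_eq_poly: "alternating_sum xs = poly (Poly xs) (- 1)"
  by (induction xs) simp_all

lemma Bell_poly_eq_Poly: "Bell_poly n = Poly ((Bell_row_step 0 0 ^^ n) [1])"
  by (induction n) (simp_all add: Bell_poly_0 Bell_poly_Suc Poly_Bell_row_step one_pCons)

lemma complementary_Bell_code:
  "complementary_Bell n = alternating_sum ((Bell_row_step 0 0 ^^ n) [1])"
  by (simp add: complementary_Bell_def Bell_poly_eq_Poly alternating_sum_eq_poly)

lemma complementary_Bell_add_12_neq:
  assumes "r < 12"
  shows "complementary_Bell (r + 12) \<noteq> complementary_Bell r"
proof -
  have "\<forall>r\<in>set [0..<12]. let xs = (Bell_row_step 0 0 ^^ r) [1]
      in alternating_sum ((Bell_row_step 0 0 ^^ 12) xs) \<noteq> alternating_sum xs"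
    by code_simp
  moreover have "r \<in> set [0..<12]" using assms by simp
  ultimately have neq: "let xs = (Bell_row_step 0 0 ^^ r) [1]
      in alternating_sum ((Bell_row_step 0 0 ^^ 12) xs) \<noteq> alternating_sum xs"
    by (rule bspec)
  have "(Bell_row_step 0 0 ^^ (r + 12)) [1]
      = (Bell_row_step 0 0 ^^ 12) ((Bell_row_step 0 0 ^^ r) [1])"
    by (subst add.commute, subst funpow_add) (rule o_apply)
  then show ?thesis
    using neq unfolding complementary_Bell_code Let_def by (rule ssubst)
qed

theorem theorem1:
  fixes c :: int
  shows "finite {n :: nat. complementary_Bell n = c}"
proof -
  have fin: "finite {m. complementary_Bell (r + 12 * m) = c}" if "r < 12" for r
  proof -
    \<comment> \<open>Subtracting \<open>c\<close> from the constant coefficient turns the fiber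
      into a zero set; divisibility survives because \<open>4 ^ 0 = 1\<close>.\<close>
    define e where "e j = Newton_coeff r j - (if j = 0 then c else 0)" for j
    have h: "(\<Sum>j\<le>m. int (m choose j) * e j) = complementary_Bell (r + 12 * m) - c" for m
    proof -
      have "(\<Sum>j\<le>m. int (m choose j) * (if j = 0 then c else 0)) = (\<Sum>j\<le>m. if j = 0 then c else 0)"
        by (rule sum.cong) auto
      then show ?thesis
        by (simp add: e_def complementary_Bell_Newton right_diff_distrib sum_subtractf)
    qed
    have "4 ^ j dvd e j" for j
      using Newton_coeff_dvd[of j r] by (cases j) (auto simp: e_def)
    \<comment> \<open>The cases \<open>m = 0\<close> and \<open>m = 1\<close> of \<open>h\<close>
      show that \<open>e 1\<close> is
      \<open>complementary_Bell (r + 12) - complementary_Bell r\<close>, whatever \<open>c\<close>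
      is.\<close>
    moreover have "e 1 \<noteq> 0"
      using h[of 0] h[of 1] complementary_Bell_add_12_neq[OF that] by auto
    ultimately show ?thesis
      using finite_zeros_Newton_series[of e 1] by (simp add: h)
  qed
  have "{n. complementary_Bell n = c} \<subseteq> (\<Union>r<12. (\<lambda>m. r + 12 * m) ` {m. complementary_Bell (r + 12 * m) = c})"
  proof
    fix n assume n: "n \<in> {n. complementary_Bell n = c}"
    have "n = n mod 12 + 12 * (n div 12)" "n mod 12 < 12" by auto
    then show "n \<in> (\<Union>r<12. (\<lambda>m. r + 12 * m) ` {m. complementary_Bell (r + 12 * m) = c})"
      using n by fastforce
  qed
  then show ?thesis by (rule finite_subset) (use fin in auto)
qed

end
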